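(* Let $A\in\mathbb{R}^{n\times n}$ be a square non-singular matrix with spectral norm $\gamma = \|A\|$, and let $P(z)$ be a monic real polynomial (of any degree $d\ge 0$) that is stable. Put $k = d+2$ and define real numbers $p_1,\dots,p_k,q_1,\dots,q_k$ by $$z(z-1)P(z) = z^k - p_1z^{k-1} - \dots - p_k, \qquad (2z-1)P(z) = q_1z^{k-1} + q_2 z^{k-2} + \dots + q_k .$$ Then for every $\eta$ with $0 < \eta < \frac{1}{\sqrt3\,\gamma}$ and all initial conditions $\mathbf{x}_0,\dots,\mathbf{x}_{k-1},\mathbf{y}_0,\dots,\mathbf{y}_{k-1}\in\mathbb{R}^n$, the HGDA dynamics $$\mathbf{x}_{t+k} = \sum_{i=1}^k p_i \mathbf{x}_{t+k-i} - \eta \sum_{i=1}^k q_i A\mathbf{y}_{t+k-i}, \qquad \mathbf{y}_{t+k} = \sum_{i=1}^k p_i \mathbf{y}_{t+k-i} + \eta \sum_{i=1}^k q_i A^T\mathbf{x}_{t+k-i} \qquad (t\ge 0)$$ converge as $t\to\infty$ to the Nash equilibrium of the bilinear game $f(\mathbf{x},\mathbf{y})=\mathbf{x}^TA\mathbf{y}$.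
   Context: HGDA stands for Historical Gradient Descent/Ascent with time horizon $k$. A polynomial is stable if all of its complex roots $z$ satisfy $|z|<1$ (the constant polynomial $1$ is stable). The spectral norm $\|S\|$ is the square root of the largest eigenvalue of $S^TS$. A Nash equilibrium is a pair $(\mathbf{x}^*,\mathbf{y}^* )$ with $f(\mathbf{x}^*,\mathbf{y}) \le f(\mathbf{x}^*,\mathbf{y}^* ) \le f(\mathbf{x},\mathbf{y}^* )$ for all $\mathbf{x},\mathbf{y}\in\mathbb{R}^n$; since $A$ is square and non-singular it is unique and equals $(\mathbf{0},\mathbf{0})$. *)

theory Defs
  imports "HOL-Analysis.Analysis" "HOL-Computational_Algebra.Polynomial"
begin

definition matrix_eigenvalue :: "real^'n^'n \<Rightarrow> real \<Rightarrow> bool" where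
  "matrix_eigenvalue M l \<longleftrightarrow> (\<exists>v. v \<noteq> 0 \<and> M *v v = l *\<^sub>R v)"

(* The greatest element exists because S^T S is symmetric (spectral theorem). *)
definition spectral_norm :: "real^'n^'m \<Rightarrow> real" where
  "spectral_norm S = sqrt (GREATEST l. matrix_eigenvalue (transpose S ** S) l)"

definition stable_poly :: "real poly \<Rightarrow> bool" where
  "stable_poly P \<longleftrightarrow> (\<forall>z::complex. poly (map_poly complex_of_real P) z = 0 \<longrightarrow> norm z < 1)"

(* The first player (x) minimises f, the second player (y) maximises it. *)
definition nash_equilibrium :: "('a \<Rightarrow> 'b \<Rightarrow> real) \<Rightarrow> 'a \<Rightarrow> 'b \<Rightarrow> bool" where
  "nash_equilibrium f xs ys \<longleftrightarrow> (\<forall>x y. f xs y \<le> f xs ys \<and> f xs ys \<le> f x ys)"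

definition bilinear_game :: "real^'n^'m \<Rightarrow> real^'m \<Rightarrow> real^'n \<Rightarrow> real" where
  "bilinear_game A x y = x \<bullet> (A *v y)"

(* HGDA on the bilinear game of A with time horizon k. The initial conditions
   x 0, ..., x (k - 1) and y 0, ..., y (k - 1) are unconstrained; only the values of
   p and q at 1, ..., k matter. *)
definition hgda ::
  "real^'n^'m \<Rightarrow> nat \<Rightarrow> (nat \<Rightarrow> real) \<Rightarrow> (nat \<Rightarrow> real) \<Rightarrow> real \<Rightarrow>
    (nat \<Rightarrow> real^'m) \<Rightarrow> (nat \<Rightarrow> real^'n) \<Rightarrow> bool" where
  "hgda A k p q \<eta> x y \<longleftrightarrow> (\<forall>t.
     x (t + k) = (\<Sum>i=1..k. p i *\<^sub>R x (t + k - i))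
                 - \<eta> *\<^sub>R (\<Sum>i=1..k. q i *\<^sub>R (A *v y (t + k - i))) \<and>
     y (t + k) = (\<Sum>i=1..k. p i *\<^sub>R y (t + k - i))
                 + \<eta> *\<^sub>R (\<Sum>i=1..k. q i *\<^sub>R (transpose A *v x (t + k - i))))"

end

(* Put S (x, y) = \<eta> (- A y, A\<^sup>T x), a skew operator of norm at most \<sigma> = \<eta> \<gamma> with 3 \<sigma>\<^sup>2 < 1. With E the shift
   and w t = (x t, y t), the dynamics are E (E - 1) P(E) w = S (2 E - 1) P(E) w, so v = P(E) w
   follows optimistic gradient descent/ascent, with characteristic polynomial
   z\<^sup>2 - (1 + 2 S) z + S. As the Schur-Cohn form suggests, put
   d t = (1 + S\<^sup>2) (v t) - (1 - S + 2 S\<^sup>2) (v (t + 1)); then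
     U t = |d t|\<^sup>2 + |S (v (t + 1))|\<^sup>2 - 3 |S\<^sup>2 (v (t + 1))|\<^sup>2 \<ge> 0 and U t - U (t + 1) = |d t|\<^sup>2 - |S (d t)|\<^sup>2,
   whence d \<longlonglongrightarrow> 0. Eliminating v t gives S\<^sup>2 (1 + 3 S\<^sup>2) (v t) \<longlonglongrightarrow> 0, and this operator is
   injective, so v \<longlonglongrightarrow> 0. Finally P(E) w \<longlonglongrightarrow> 0 forces w \<longlonglongrightarrow> 0, by splitting off the complex
   linear factors of P one at a time. *)
theory Submission
  imports Defs "HOL-Computational_Algebra.Fundamental_Theorem_Algebra"
begin

section \<open>Polynomials acting on sequences by shifts\<close>

text \<open>With \<open>E\<close> the shift of sequences, this is \<open>Q(E) w\<close> at time
  \<open>t\<close>. The fold is Horner's scheme, suited to induction along \<open>pCons\<close>. The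
  scalar action \<open>sc\<close> is a parameter because real polynomials act on vectors and complex
  ones on complex sequences.\<close>

definition shift_poly ::
  "('a::comm_ring_1 \<Rightarrow> 'b::ab_group_add \<Rightarrow> 'b) \<Rightarrow> 'a poly \<Rightarrow> (nat \<Rightarrow> 'b) \<Rightarrow> nat \<Rightarrow> 'b" where
  "shift_poly sc Q w = fold_coeffs (\<lambda>a g t. sc a (w t) + g (Suc t)) Q (\<lambda>_. 0)"

lemma module_scaleR [simp]: "module ((*\<^sub>R) :: real \<Rightarrow> 'a::real_vector \<Rightarrow> 'a)"
  by unfold_locales (auto simp: algebra_simps)

lemma module_mult [simp]: "module ((*) :: 'a::comm_ring_1 \<Rightarrow> 'a \<Rightarrow> 'a)"
  by unfold_locales (auto simp: algebra_simps)

lemma shift_poly_0 [simp]: "shift_poly sc 0 w t = 0"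
  by (simp add: shift_poly_def)

lemma shift_poly_pCons [simp]:
  assumes "module sc"
  shows "shift_poly sc (pCons a Q) w t = sc a (w t) + shift_poly sc Q w (Suc t)"
  by (cases "a = 0 \<and> Q = 0") (auto simp: shift_poly_def module.scale_zero_left[OF assms])

lemma shift_poly_add:
  assumes "module sc"
  shows "shift_poly sc (Q + R) w t = shift_poly sc Q w t + shift_poly sc R w t"
  by (induction Q R arbitrary: t rule: poly_induct2)
     (auto simp: assms module.scale_left_distrib[OF assms])

lemma shift_poly_smult:
  assumes "module sc"
  shows "shift_poly sc (smult a Q) w t = sc a (shift_poly sc Q w t)"
  by (induction Q arbitrary: t)
     (auto simp: assms module.scale_right_distrib[OF assms] module.scale_scale[OF assms]
        module.scale_zero_right[OF assms])

text \<open>Products become compositions, so a right factor can be absorbed into the sequence. This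
  isolates \<open>P(E) w\<close> in the dynamics and later splits off the roots of
  \<open>P\<close>.\<close>

lemma shift_poly_mult:
  assumes "module sc"
  shows "shift_poly sc (Q * R) w t = shift_poly sc Q (shift_poly sc R w) t"
  by (induction Q arbitrary: t)
     (auto simp: assms shift_poly_add shift_poly_smult module.scale_zero_left[OF assms])

lemma shift_poly_monom:
  assumes "module sc"
  shows "shift_poly sc (monom a n) w t = sc a (w (t + n))"
  by (induction n arbitrary: t)
     (auto simp: assms monom_0 monom_Suc module.scale_zero_left[OF assms])

lemma shift_poly_diff:
  assumes "module sc"
  shows "shift_poly sc (Q - R) w t = shift_poly sc Q w t - shift_poly sc R w t"
  using shift_poly_add[OF assms, of "Q - R" R w t] by simp

lemma shift_poly_sum:
  assumes "module sc"
  shows "shift_poly sc (sum f I) w t = (\<Sum>i\<in>I. shift_poly sc (f i) w t)"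
  by (induction I rule: infinite_finite_induct) (auto simp: shift_poly_add[OF assms])

lemma linear_shift_poly:
  assumes "linear S"
  shows "shift_poly (*\<^sub>R) Q (\<lambda>t. S (w t)) t = S (shift_poly (*\<^sub>R) Q w t)"
  by (induction Q arbitrary: t)
     (auto simp: linear_0[OF assms] linear_add[OF assms] linear_scale[OF assms])

lemma of_real_shift_poly:
  "shift_poly (*) (map_poly of_real Q) (\<lambda>t. of_real (f t) :: complex) t
     = of_real (shift_poly (*\<^sub>R) Q f t)"
  by (induction Q arbitrary: t) (auto simp: map_poly_pCons)

section \<open>Decay for stable linear recurrences with null input\<close>

lemma tendsto_zero_first_order:
  fixes c :: complex
  assumes c: "norm c < 1" and lim: "(\<lambda>t. u (Suc t) - c * u t) \<longlonglongrightarrow> 0"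
  shows "u \<longlonglongrightarrow> 0"
proof (rule LIMSEQ_I)
  fix r :: real assume r: "r > 0"
  \<comment> \<open>Chosen so that \<open>r / 2\<close> solves \<open>s = norm c * s + e\<close>;
    hence the bound in \<open>step\<close> reproduces itself.\<close>
  define e where "e = r / 2 * (1 - norm c)"
  have "e > 0" using r c by (simp add: e_def)
  obtain N where N: "\<And>t. t \<ge> N \<Longrightarrow> norm (u (Suc t) - c * u t) < e"
    using LIMSEQ_D[OF lim \<open>e > 0\<close>] by auto
  have step: "norm (u (N + m)) \<le> norm c ^ m * norm (u N) + r / 2" for m
  proof (induction m)
    case (Suc m)
    have "norm (u (N + Suc m)) \<le> norm (u (Suc (N + m)) - c * u (N + m)) + norm (c * u (N + m))"
      using norm_triangle_sub[of "u (Suc (N + m))" "c * u (N + m)"] by simp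
    also have "\<dots> \<le> e + norm c * (norm c ^ m * norm (u N) + r / 2)"
      using N[of "N + m"] mult_left_mono[OF Suc, of "norm c"] by (simp add: norm_mult)
    also have "\<dots> = norm c ^ Suc m * norm (u N) + r / 2"
      by (simp add: e_def field_simps)
    finally show ?case by simp
  qed (use r in auto)
  have "(\<lambda>m. norm c ^ m * norm (u N)) \<longlonglongrightarrow> 0"
    using c by (intro tendsto_mult_left_zero LIMSEQ_power_zero) auto
  then obtain M where M: "\<And>m. m \<ge> M \<Longrightarrow> norm c ^ m * norm (u N) < r / 2"
    using r LIMSEQ_D[of _ 0 "r / 2"] by fastforce
  show "\<exists>n0. \<forall>n\<ge>n0. norm (u n - 0) < r"
  proof (intro exI allI impI)
    fix n assume "n \<ge> N + M"
    then show "norm (u n - 0) < r"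
      using step[of "n - N"] M[of "n - N"] by (force simp: field_simps)
  qed
qed

text \<open>For a root \<open>c\<close>, \<open>Q(E) = (E - c) R(E)\<close>, so
  \<open>R(E) u\<close> solves a first-order recurrence with null input and ratio \<open>c\<close>.
  It therefore tends to 0, and the induction continues with \<open>R\<close>.\<close>

lemma tendsto_zero_shift_poly_complex:
  fixes Q :: "complex poly"
  assumes "Q \<noteq> 0" "\<And>z. poly Q z = 0 \<Longrightarrow> norm z < 1"
    and "shift_poly (*) Q u \<longlonglongrightarrow> 0"
  shows "u \<longlonglongrightarrow> 0"
  using assms
proof (induction "degree Q" arbitrary: Q u)
  case 0
  then obtain a where a: "Q = [:a:]" "a \<noteq> 0"
    by (metis degree_eq_zeroE pCons_0_0)
  have "shift_poly (*) Q u = (\<lambda>t. a * u t)"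
    by (auto simp: a)
  with 0 a show ?case
    using tendsto_mult_left[of "\<lambda>t. a * u t" 0 sequentially "inverse a"]
    by (simp add: field_simps)
next
  case (Suc n)
  then have "\<not> constant (poly Q)"
    by (simp add: constant_degree)
  then obtain c where c: "poly Q c = 0"
    using fundamental_theorem_of_algebra by blast
  then obtain R where R: "Q = [:-c, 1:] * R"
    by (metis poly_eq_0_iff_dvd dvdE)
  have "R \<noteq> 0" using R Suc by auto
  have "degree R = n"
    using Suc(2) degree_mult_eq[of "[:-c, 1:]" R] \<open>R \<noteq> 0\<close> unfolding R by simp
  moreover have "norm z < 1" if "poly R z = 0" for z
    using Suc that by (simp add: R)
  moreover have "shift_poly (*) R u \<longlonglongrightarrow> 0"
  proof (rule tendsto_zero_first_order)
    show "norm c < 1" using Suc c by blast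
    have "shift_poly (*) Q u t = shift_poly (*) R u (Suc t) - c * shift_poly (*) R u t" for t
      unfolding R shift_poly_mult[OF module_mult] by simp
    then show "(\<lambda>t. shift_poly (*) R u (Suc t) - c * shift_poly (*) R u t) \<longlonglongrightarrow> 0"
      using Suc.prems(3) by presburger
  qed
  ultimately show ?case using Suc.hyps(1) \<open>R \<noteq> 0\<close> by blast
qed

text \<open>Coordinates reduce this to scalar sequences, which are then made complex because
  \<open>P\<close> need not split over the reals.\<close>

lemma tendsto_zero_shift_poly:
  fixes P :: "real poly" and w :: "nat \<Rightarrow> 'a::euclidean_space"
  assumes "P \<noteq> 0" "stable_poly P" and lim: "shift_poly (*\<^sub>R) P w \<longlonglongrightarrow> 0"
  shows "w \<longlonglongrightarrow> 0"
proof (rule tendsto_componentwise_iff[THEN iffD2], intro ballI)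
  fix b :: 'a assume "b \<in> Basis"
  have lin: "linear (\<lambda>v. v \<bullet> b)"
    by (simp add: bounded_linear.linear bounded_linear_inner_left)
  have "(\<lambda>t. shift_poly (*\<^sub>R) P w t \<bullet> b) \<longlonglongrightarrow> 0"
    using tendsto_inner[OF lim tendsto_const] by simp
  then have "(\<lambda>t. shift_poly (*\<^sub>R) P (\<lambda>t. w t \<bullet> b) t) \<longlonglongrightarrow> 0"
    unfolding linear_shift_poly[OF lin, of P w] .
  then have "(\<lambda>t. complex_of_real (shift_poly (*\<^sub>R) P (\<lambda>t. w t \<bullet> b) t)) \<longlonglongrightarrow> 0"
    using tendsto_of_real by fastforce
  then have "shift_poly (*) (map_poly of_real P) (\<lambda>t. complex_of_real (w t \<bullet> b)) \<longlonglongrightarrow> 0"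
    by (simp add: of_real_shift_poly[abs_def])
  moreover have "map_poly complex_of_real P \<noteq> 0"
    using assms(1) by (simp add: map_poly_eq_0_iff)
  ultimately have "(\<lambda>t. complex_of_real (w t \<bullet> b)) \<longlonglongrightarrow> 0"
    using assms(2) tendsto_zero_shift_poly_complex unfolding stable_poly_def by blast
  then show "(\<lambda>t. w t \<bullet> b) \<longlonglongrightarrow> 0 \<bullet> b"
    using tendsto_of_real_iff[of "\<lambda>t. w t \<bullet> b" 0, where 'a = complex] by simp
qed

section \<open>Recurrences driven by a skew operator\<close>

text \<open>\<open>w0\<close> and \<open>w1\<close> are consecutive values of the sequence
  \<open>d\<close>, so this is the formula for \<open>U t - U (t + 1)\<close> in rearranged
  form.\<close>

lemma skew_recurrence_energy:
  fixes S :: "'a::real_inner \<Rightarrow> 'a"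
  assumes S: "linear S" and skew: "\<And>u v. S u \<bullet> v = - (u \<bullet> S v)"
    and v2: "v2 = v1 + 2 *\<^sub>R S v1 - S v0"
    and w0: "w0 = v0 + S (S v0) - v1 + S v1 - 2 *\<^sub>R S (S v1)"
    and w1: "w1 = v1 + S (S v1) - v2 + S v2 - 2 *\<^sub>R S (S v2)"
  shows "(norm w1)\<^sup>2 + (norm (S v2))\<^sup>2 - 3 * (norm (S (S v2)))\<^sup>2
       = (norm (S w0))\<^sup>2 + (norm (S v1))\<^sup>2 - 3 * (norm (S (S v1)))\<^sup>2"
proof -
  \<comment> \<open>Once \<open>v2\<close> is eliminated, the bare \<open>v1\<close> cancels in
    \<open>w1\<close>, and both sides become quadratic forms in \<open>a\<close> and
    \<open>b\<close>.\<close>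
  define a b where "a = S v0" and "b = S v1"
  note lin = linear_add[OF S] linear_diff[OF S] linear_scale[OF S]
  have sw: "v \<bullet> S u = - (u \<bullet> S v)" for u v
    by (metis skew inner_commute)
  have odd0: "u \<bullet> S u = 0" for u
    using sw[of u u] by simp
  have w1': "w1 = a - S a + 2 *\<^sub>R S (S a) - b + S b - 4 *\<^sub>R S (S b)"
    by (simp add: w1 v2 lin a_def b_def algebra_simps flip: scaleR_add_left scaleR_2)
  have w0': "S w0 = a + S (S a) - b + S b - 2 *\<^sub>R S (S b)"
    by (simp add: w0 lin a_def b_def)
  have v2': "S v2 = b + 2 *\<^sub>R S b - S a"
    by (simp add: v2 lin a_def b_def)
  \<comment> \<open>Normal form: skewness moves every \<open>S\<close> to the right argument,
    \<open>e\<close> puts \<open>a\<close> before \<open>b\<close>, and \<open>odd0\<close> and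
    \<open>o\<close> remove odd powers of \<open>S\<close> between equal vectors.\<close>
  have e: "b \<bullet> a = a \<bullet> b" "b \<bullet> S a = - (a \<bullet> S b)" "b \<bullet> S (S a) = a \<bullet> S (S b)"
     "b \<bullet> S (S (S a)) = - (a \<bullet> S (S (S b)))" "b \<bullet> S (S (S (S a))) = a \<bullet> S (S (S (S b)))"
    using inner_commute[of b a] inner_commute[of "S b" a] inner_commute[of "S (S b)" a]
      inner_commute[of "S (S (S b))" a] inner_commute[of "S (S (S (S b)))" a]
    by (simp_all add: skew)
  have o: "u \<bullet> S (S (S u)) = 0" for u
    using odd0[of "S u"] skew[of u "S (S u)"] by simp
  show ?thesis
    unfolding w1' w0' v2' b_def[symmetric] power2_norm_eq_inner
    by (simp add: lin inner_simps skew e odd0 o algebra_simps)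
qed

lemma skew_recurrence_tendsto_zero:
  fixes S :: "'a::euclidean_space \<Rightarrow> 'a"
  assumes S: "linear S" and skew: "\<And>u v. S u \<bullet> v = - (u \<bullet> S v)"
    and inj: "inj S" and bound: "\<And>u. norm (S u) \<le> \<sigma> * norm u" and \<sigma>: "0 \<le> \<sigma>" "3 * \<sigma>\<^sup>2 < 1"
    and rec: "\<And>t. v (Suc (Suc t)) = v (Suc t) + 2 *\<^sub>R S (v (Suc t)) - S (v t)"
  shows "v \<longlonglongrightarrow> 0"
proof -
  note lin = linear_add[OF S] linear_diff[OF S] linear_scale[OF S]
  \<comment> \<open>This is the sequence \<open>d\<close>.\<close>
  define w where
    "w t = v t + S (S (v t)) - v (Suc t) + S (v (Suc t)) - 2 *\<^sub>R S (S (v (Suc t)))" for t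
  define U where
    "U t = (norm (w t))\<^sup>2 + (norm (S (v (Suc t))))\<^sup>2 - 3 * (norm (S (S (v (Suc t)))))\<^sup>2" for t
  have bound2: "(norm (S u))\<^sup>2 \<le> \<sigma>\<^sup>2 * (norm u)\<^sup>2" for u
    using power_mono[OF bound[of u], of 2] by (simp add: power_mult_distrib)
  have contr: "3 * (norm (S u))\<^sup>2 \<le> (norm u)\<^sup>2" for u
    using bound2[of u] mult_right_mono[of "3 * \<sigma>\<^sup>2" 1 "(norm u)\<^sup>2"] \<sigma> by simp
  have U_nonneg: "0 \<le> U t" for t
    using contr[of "S (v (Suc t))"] zero_le_power2[of "norm (w t)"] unfolding U_def by linarith
  have diff: "U t - U (Suc t) = (norm (w t))\<^sup>2 - (norm (S (w t)))\<^sup>2" for t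
    using skew_recurrence_energy[OF S skew rec[of t] w_def[of t] w_def[of "Suc t"]]
    by (simp add: U_def)
  \<comment> \<open>By \<open>contr\<close>, each step lowers \<open>U\<close> by at least two
    thirds of the squared norm of \<open>w t\<close>. As \<open>U\<close> is bounded below, it
    converges, so these decrements vanish in the limit.\<close>
  have drop: "2 * (norm (w t))\<^sup>2 \<le> 3 * (U t - U (Suc t))" for t
    using diff[of t] contr[of "w t"] by simp
  have "decseq U"
    by (rule decseq_SucI) (use drop in \<open>smt (verit) zero_le_power2\<close>)
  then obtain L where L: "U \<longlonglongrightarrow> L"
    using decseq_convergent U_nonneg by blast
  have "(\<lambda>t. 3 / 2 * (U t - U (Suc t))) \<longlonglongrightarrow> 0"
    using tendsto_mult[OF tendsto_const[of "3 / 2"] tendsto_diff[OF L LIMSEQ_Suc[OF L]]] by simp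
  then have "(\<lambda>t. (norm (w t))\<^sup>2) \<longlonglongrightarrow> 0"
    by (rule real_tendsto_sandwich[OF _ _ tendsto_const, rotated -1])
       (use drop in \<open>auto intro!: always_eventually simp: field_simps\<close>)
  then have w: "w \<longlonglongrightarrow> 0"
    using tendsto_real_sqrt[of "\<lambda>t. (norm (w t))\<^sup>2" 0] by (simp add: tendsto_norm_zero_iff)
  \<comment> \<open>The resultant of \<open>z\<^sup>2 - (1 + 2 S) z + S\<close> and \<open>(1 - S + 2 S\<^sup>2) z - (1 + S\<^sup>2)\<close>
    with respect to \<open>z\<close> is \<open>- S\<^sup>2 (1 + 3 S\<^sup>2)\<close>.\<close>
  define g where "g u = S (S u) + 3 *\<^sub>R S (S (S (S u)))" for u
  have resultant: "g (v (Suc t)) = 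
      - (w (Suc t) + S (S (w (Suc t)))) + S (w t) - S (S (w t)) + 2 *\<^sub>R S (S (S (w t)))" for t
    \<comment> \<open>The weights \<open>- (1 + S\<^sup>2)\<close> of \<open>w (Suc t)\<close> and
      \<open>S (1 - S + 2 S\<^sup>2)\<close> of \<open>w t\<close> make the terms in
      \<open>v t\<close> cancel.\<close>
    by (rule vector_eq_ldot[THEN iffD1]) (simp add: g_def w_def rec lin inner_simps algebra_simps)
  have cont: "isCont S u" for u
    using linear_continuous_at[OF linear_conv_bounded_linear[THEN iffD1, OF S]] .
  have Slim: "(\<lambda>t. S (f t)) \<longlonglongrightarrow> 0" if "f \<longlonglongrightarrow> 0" for f :: "nat \<Rightarrow> 'a"
    using isCont_tendsto_compose[OF cont that] linear_0[OF S] by simp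
  have w': "(\<lambda>t. w (Suc t)) \<longlonglongrightarrow> 0"
    using LIMSEQ_Suc[OF w] .
  have "(\<lambda>t. - (w (Suc t) + S (S (w (Suc t)))) + S (w t) - S (S (w t)) + 2 *\<^sub>R S (S (S (w t))))
          \<longlonglongrightarrow> - (0 + 0) + 0 - 0 + 2 *\<^sub>R 0"
    by (intro tendsto_intros w w' Slim)
  then have g_lim: "(\<lambda>t. g (v (Suc t))) \<longlonglongrightarrow> 0"
    by (simp add: resultant)
  have "linear g"
    unfolding g_def by (rule linearI) (simp_all add: lin algebra_simps)
  moreover have "inj g"
  proof (rule linear_injective_0[THEN iffD2, OF \<open>linear g\<close>], intro allI impI)
    fix u assume "g u = 0"
    \<comment> \<open>Now \<open>g u = 0\<close> reads \<open>a = - 3 S\<^sup>2 a\<close>, which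
      \<open>3 * \<sigma>\<^sup>2 < 1\<close> allows only for \<open>a = 0\<close>.\<close>
    define a where "a = S (S u)"
    have "norm a = 3 * norm (S (S a))"
      using \<open>g u = 0\<close> unfolding g_def a_def[symmetric]
      by (metis add_eq_0_iff2 norm_minus_cancel norm_scaleR abs_numeral)
    moreover have "norm (S (S a)) \<le> \<sigma>\<^sup>2 * norm a"
      using bound[of "S a"] mult_left_mono[OF bound[of a] \<sigma>(1)] by (simp add: power2_eq_square)
    ultimately have "(1 - 3 * \<sigma>\<^sup>2) * norm a \<le> 0"
      by (simp add: algebra_simps)
    then have "a = 0"
      using \<sigma> by (simp add: mult_le_0_iff)
    then show "u = 0"
      unfolding a_def using inj linear_0[OF S] by (metis injD)
  qed
  ultimately obtain B where B: "B > 0" "\<And>u. B * norm u \<le> norm (g u)"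
    using linear_inj_bounded_below_pos by blast
  have "(\<lambda>t. norm (g (v (Suc t))) / B) \<longlonglongrightarrow> 0"
    using tendsto_divide[OF tendsto_norm_zero[OF g_lim] tendsto_const[of B]] B(1) by simp
  then have "(\<lambda>t. v (Suc t)) \<longlonglongrightarrow> 0"
    by (rule Lim_null_comparison[rotated]) (use B in \<open>auto simp: field_simps\<close>)
  then show ?thesis
    by (rule LIMSEQ_imp_Suc)
qed

section \<open>The spectral norm and the bilinear game\<close>

lemma transpose_inner: "(transpose A *v u) \<bullet> v = u \<bullet> (A *v v)" for A :: "real^'n^'m"
  by (simp add: dot_lmul_matrix)

declare transpose_matrix_vector [simp del]

text \<open>The greatest eigenvalue must be shown to exist. Compactness gives a unit vector
  \<open>e\<close> maximising \<open>norm (A *v e)\<close>; it is an eigenvector of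
  \<open>G\<close>, and the squared maximum is the largest eigenvalue.\<close>

lemma norm_matrix_le_spectral_norm:
  fixes A :: "real^'n^'m"
  shows "norm (A *v u) \<le> spectral_norm A * norm u"
proof -
  have "continuous_on (sphere (0 :: real^'n) 1) (\<lambda>v. norm (A *v v))"
    by (intro continuous_intros linear_continuous_on) (simp add: linear_conv_bounded_linear[symmetric])
  moreover have "sphere (0 :: real^'n) 1 \<noteq> {}"
    by simp
  ultimately obtain e where e: "norm e = 1" "\<And>v. norm v = 1 \<Longrightarrow> norm (A *v v) \<le> norm (A *v e)"
    using continuous_attains_sup[OF compact_sphere] by (metis dist_0_norm mem_sphere)
  define m where "m = norm (A *v e)"
  have m0: "0 \<le> m" by (simp add: m_def)
  have le: "norm (A *v v) \<le> m * norm v" for v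
  proof (cases "v = 0")
    case False
    have "norm (A *v (v /\<^sub>R norm v)) \<le> m"
      unfolding m_def using False by (intro e) simp
    then show ?thesis
      using False by (simp add: matrix_vector_mult_scaleR field_simps)
  qed simp
  define G where "G = transpose A ** A"
  have G: "(G *v v) \<bullet> u = (A *v v) \<bullet> (A *v u)" for u v
    by (simp add: G_def transpose_inner flip: matrix_vector_mul_assoc)
  \<comment> \<open>Cauchy-Schwarz bounds the squared norm of \<open>G *v v\<close>, and one factor
    \<open>norm (G *v v)\<close> is cancelled.\<close>
  have G_norm: "norm (G *v v) \<le> m * norm (A *v v)" for v
  proof -
    have "(norm (G *v v))\<^sup>2 \<le> norm (A *v v) * norm (A *v (G *v v))"
      using norm_cauchy_schwarz[of "A *v v" "A *v (G *v v)"] by (simp add: power2_norm_eq_inner G)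
    also have "\<dots> \<le> norm (A *v v) * (m * norm (G *v v))"
      by (intro mult_left_mono le) simp
    finally show ?thesis
      using m0 by (cases "norm (G *v v) = 0") (auto simp: power2_eq_square mult_ac)
  qed
  \<comment> \<open>The defect of the eigenvector equation for \<open>e\<close> vanishes, since
    \<open>norm (G *v e)\<close> is at most \<open>m\<^sup>2\<close>.\<close>
  have "(norm (G *v e - m\<^sup>2 *\<^sub>R e))\<^sup>2 = (norm (G *v e))\<^sup>2 - 2 * m\<^sup>2 * m\<^sup>2 + (m\<^sup>2)\<^sup>2"
  proof -
    have "(G *v e) \<bullet> e = m\<^sup>2" "e \<bullet> (G *v e) = m\<^sup>2" "e \<bullet> e = 1"
      using e(1) G[of e e] by (simp_all add: m_def power2_norm_eq_inner inner_commute norm_eq_1)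
    then show ?thesis
      unfolding power2_norm_eq_inner by (simp add: inner_diff power2_eq_square[of "m\<^sup>2"])
  qed
  also have "\<dots> \<le> 0"
    using power_mono[OF G_norm[of e], of 2]
    by (simp add: m_def[symmetric] power_mult_distrib power2_eq_square)
  finally have "matrix_eigenvalue G (m\<^sup>2)"
    unfolding matrix_eigenvalue_def using e(1) by (intro exI[of _ e]) auto
  moreover have "l \<le> m\<^sup>2" if "matrix_eigenvalue G l" for l
  proof -
    from that obtain v where v: "v \<noteq> 0" "G *v v = l *\<^sub>R v"
      unfolding matrix_eigenvalue_def by blast
    have "l * (norm v)\<^sup>2 = (norm (A *v v))\<^sup>2"
      using G[of v v] by (simp add: v power2_norm_eq_inner)
    also have "\<dots> \<le> m\<^sup>2 * (norm v)\<^sup>2"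
      using power_mono[OF le[of v], of 2] by (simp add: power_mult_distrib)
    finally show ?thesis using v(1) by simp
  qed
  ultimately have "spectral_norm A = sqrt (m\<^sup>2)"
    unfolding spectral_norm_def G_def[symmetric] by (intro arg_cong[of _ _ sqrt] Greatest_equality)
  with le m0 show ?thesis by simp
qed

text \<open>Moving one transpose across the inner product reduces the squared norm to the bound for
  \<open>A\<close>; a common factor then cancels.\<close>

lemma norm_transpose_le_spectral_norm:
  fixes A :: "real^'n^'m"
  shows "norm (transpose A *v u) \<le> spectral_norm A * norm u"
proof -
  have "(norm (transpose A *v u))\<^sup>2 = u \<bullet> (A *v (transpose A *v u))"
    by (simp add: power2_norm_eq_inner transpose_inner)
  also have "\<dots> \<le> norm u * (spectral_norm A * norm (transpose A *v u))"
    using norm_cauchy_schwarz mult_left_mono[OF norm_matrix_le_spectral_norm norm_ge_zero]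
    by (rule order_trans)
  finally have *: "norm (transpose A *v u) * norm (transpose A *v u)
      \<le> norm (transpose A *v u) * (spectral_norm A * norm u)"
    by (simp add: power2_eq_square mult_ac)
  \<comment> \<open>Covers \<open>transpose A *v u = 0\<close>, where the common factor cannot be
    cancelled.\<close>
  have "0 \<le> spectral_norm A * norm u"
  proof -
    obtain e :: "real^'n" where "norm e = 1"
      using vector_choose_size[of 1] by auto
    then have "0 \<le> spectral_norm A"
      using norm_matrix_le_spectral_norm[of A e] norm_ge_zero[of "A *v e"]
      by (metis mult.right_neutral order_trans)
    then show ?thesis by simp
  qed
  with * show ?thesis
    by (cases "transpose A *v u = 0") auto
qed

lemma invertible_mult_vector_eq_0:
  fixes A :: "real^'n^'n"
  assumes "invertible A"
  shows "A *v u = 0 \<longleftrightarrow> u = 0"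
proof
  have "\<forall>x. A *v x = 0 \<longrightarrow> x = 0"
    using assms unfolding invertible_left_inverse matrix_left_invertible_ker .
  then show "u = 0" if "A *v u = 0"
    using that by blast
qed simp

text \<open>At an equilibrium neither player gains by a gradient step, to \<open>u - A *v v\<close>
  or to \<open>v + transpose A *v u\<close>, so both gradients vanish.\<close>

lemma nash_equilibrium_bilinear_game_iff:
  fixes A :: "real^'n^'n"
  assumes "invertible A"
  shows "nash_equilibrium (bilinear_game A) u v \<longleftrightarrow> u = 0 \<and> v = 0"
proof
  assume N: "nash_equilibrium (bilinear_game A) u v"
  have le: "u \<bullet> (A *v y) \<le> u \<bullet> (A *v v)" "u \<bullet> (A *v v) \<le> x \<bullet> (A *v v)" for x y
    using N unfolding nash_equilibrium_def bilinear_game_def by blast+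
  have "A *v v = 0"
    using le(2)[of "u - A *v v"] inner_ge_zero[of "A *v v"] by (simp add: inner_diff_left order_antisym)
  moreover have "transpose A *v u = 0"
  proof -
    have "u \<bullet> (A *v v) + u \<bullet> (A *v (transpose A *v u)) \<le> u \<bullet> (A *v v)"
      using le(1)[of "v + transpose A *v u"]
      by (simp only: matrix_vector_right_distrib inner_add_right)
    then have "(transpose A *v u) \<bullet> (transpose A *v u) \<le> 0"
      by (simp only: transpose_inner)
    then show ?thesis
      using inner_ge_zero[of "transpose A *v u"] by (metis inner_eq_zero_iff order_antisym)
  qed
  ultimately show "u = 0 \<and> v = 0"
    using invertible_mult_vector_eq_0[OF assms]
      invertible_mult_vector_eq_0[OF transpose_invertible[OF assms]] by simp
qed (simp add: nash_equilibrium_def bilinear_game_def)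

section \<open>Reduction of HGDA to the skew recurrence\<close>

theorem mainTheorem5:
  fixes A :: "real^'n^'n" and \<gamma> \<eta> :: real and P :: "real poly" and k :: nat
    and p q :: "nat \<Rightarrow> real" and x y :: "nat \<Rightarrow> real^'n"
  assumes "invertible A"
    and "\<gamma> = spectral_norm A"
    and "lead_coeff P = 1"
    and "stable_poly P"
    and "k = degree P + 2"
    and "[:0, 1:] * [:-1, 1:] * P = monom 1 k - (\<Sum>i=1..k. monom (p i) (k - i))"
    and "[:-1, 2:] * P = (\<Sum>i=1..k. monom (q i) (k - i))"
    and "0 < \<eta>" and "\<eta> < 1 / (sqrt 3 * \<gamma>)"
    and "hgda A k p q \<eta> x y"
  shows "(\<forall>u v. nash_equilibrium (bilinear_game A) u v \<longleftrightarrow> u = 0 \<and> v = 0)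
    \<and> x \<longlonglongrightarrow> 0 \<and> y \<longlonglongrightarrow> 0"
proof -
  define S where "S = (\<lambda>(u, v). (- \<eta> *\<^sub>R (A *v v), \<eta> *\<^sub>R (transpose A *v u)))"
  define w where "w t = (x t, y t)" for t
  define v where "v = shift_poly (*\<^sub>R) P w"
  have S: "linear S"
    unfolding S_def
    by (rule linearI) (auto simp: algebra_simps matrix_vector_right_distrib matrix_vector_mult_scaleR)
  have skew: "S a \<bullet> b = - (a \<bullet> S b)" for a b
  proof -
    obtain a1 a2 b1 b2 where ab: "a = (a1, a2)" "b = (b1, b2)"
      by (cases a; cases b)
    have "(A *v a2) \<bullet> b1 = a2 \<bullet> (transpose A *v b1)"
      by (metis transpose_inner inner_commute)
    then show ?thesis
      by (simp add: ab S_def transpose_inner)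
  qed
  have inj: "inj S"
  proof (rule linear_injective_0[THEN iffD2, OF S], intro allI impI)
    fix a assume "S a = 0"
    then show "a = 0"
      using \<open>0 < \<eta>\<close> invertible_mult_vector_eq_0[OF assms(1)]
        invertible_mult_vector_eq_0[OF transpose_invertible[OF assms(1)]]
      by (cases a) (auto simp: S_def zero_prod_def)
  qed
  \<comment> \<open>The range of \<open>\<eta>\<close> is nonempty, which forces
    \<open>\<gamma>\<close> to be positive; \<open>\<gamma> = 0\<close> would give the upper bound
    \<open>1 / 0 = 0\<close>.\<close>
  have "0 < 1 / (sqrt 3 * \<gamma>)"
    using assms(8,9) by linarith
  then have "0 < \<gamma>"
    by (simp add: zero_less_divide_iff zero_less_mult_iff)
  have bound: "norm (S a) \<le> (\<eta> * \<gamma>) * norm a" for a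
  proof (rule power2_le_imp_le)
    obtain a1 a2 where a: "a = (a1, a2)" by (cases a)
    have "(norm (A *v a2))\<^sup>2 \<le> (\<gamma> * norm a2)\<^sup>2" "(norm (transpose A *v a1))\<^sup>2 \<le> (\<gamma> * norm a1)\<^sup>2"
      using norm_matrix_le_spectral_norm[of A a2] norm_transpose_le_spectral_norm[of A a1]
      by (auto intro!: power_mono simp: assms(2))
    then have "\<eta>\<^sup>2 * ((norm (A *v a2))\<^sup>2 + (norm (transpose A *v a1))\<^sup>2)
        \<le> \<eta>\<^sup>2 * ((\<gamma> * norm a2)\<^sup>2 + (\<gamma> * norm a1)\<^sup>2)"
      by (intro mult_left_mono) auto
    then show "(norm (S a))\<^sup>2 \<le> ((\<eta> * \<gamma>) * norm a)\<^sup>2"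
      by (simp add: a S_def norm_Pair power_mult_distrib algebra_simps)
  qed (use \<open>0 < \<gamma>\<close> \<open>0 < \<eta>\<close> in auto)
  have "sqrt 3 * (\<eta> * \<gamma>) < 1"
    using assms(9) \<open>0 < \<gamma>\<close> by (simp add: field_simps)
  then have "(sqrt 3 * (\<eta> * \<gamma>))\<^sup>2 < 1\<^sup>2"
    using \<open>0 < \<gamma>\<close> \<open>0 < \<eta>\<close> by (intro power_strict_mono) auto
  then have small: "3 * (\<eta> * \<gamma>)\<^sup>2 < 1"
    by (simp add: power_mult_distrib)
  have "shift_poly (*\<^sub>R) ([:0, 1:] * [:-1, 1:] * P) w t
      = S (shift_poly (*\<^sub>R) ([:-1, 2:] * P) w t)" for t
  proof -
    \<comment> \<open>Monomials shift by \<open>k - i\<close>, whereas \<open>hgda\<close> subtracts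
      \<open>i\<close> from \<open>t + k\<close>; for \<open>i \<le> k\<close> the truncated
      subtractions agree.\<close>
    have *: "(\<Sum>i=1..k. c i *\<^sub>R w (t + (k - i))) = (\<Sum>i=1..k. c i *\<^sub>R w (t + k - i))"
      for c :: "nat \<Rightarrow> real"
      by (rule sum.cong) auto
    have lhs: "shift_poly (*\<^sub>R) ([:0, 1:] * [:-1, 1:] * P) w t
        = w (t + k) - (\<Sum>i=1..k. p i *\<^sub>R w (t + k - i))"
      unfolding assms(6) *[symmetric] by (simp add: shift_poly_diff shift_poly_sum shift_poly_monom)
    have rhs: "shift_poly (*\<^sub>R) ([:-1, 2:] * P) w t = (\<Sum>i=1..k. q i *\<^sub>R w (t + k - i))"
      unfolding assms(7) *[symmetric] by (simp add: shift_poly_sum shift_poly_monom)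
    have Asum: "M *v (\<Sum>i=1..k. q i *\<^sub>R f i) = (\<Sum>i=1..k. q i *\<^sub>R (M *v f i))"
      for M :: "real^'n^'n" and f
      by (simp add: linear_sum[OF matrix_vector_mul_linear] matrix_vector_mult_scaleR)
    from assms(10) show ?thesis
      unfolding lhs rhs hgda_def
      by (simp add: w_def S_def sum_prod scaleR_Pair case_prod_beta Asum fst_sum snd_sum prod_eq_iff
        del: One_nat_def)
  qed
  \<comment> \<open>Absorbing the right factor \<open>P\<close> into the sequence replaces
    \<open>w\<close> by \<open>v\<close> and leaves a second-order recurrence.\<close>
  then have "shift_poly (*\<^sub>R) ([:0, 1:] * [:-1, 1:]) v t = S (shift_poly (*\<^sub>R) [:-1, 2:] v t)" for t
    unfolding shift_poly_mult[OF module_scaleR, of _ P] v_def[symmetric] .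
  moreover have "shift_poly (*\<^sub>R) ([:0, 1:] * [:-1, 1:]) v t = v (Suc (Suc t)) - v (Suc t)" for t
    by simp
  moreover have "S (shift_poly (*\<^sub>R) [:-1, 2:] v t) = 2 *\<^sub>R S (v (Suc t)) - S (v t)" for t
    by (simp add: linear_diff[OF S] linear_scale[OF S])
  ultimately have "v (Suc (Suc t)) - v (Suc t) = 2 *\<^sub>R S (v (Suc t)) - S (v t)" for t
    by presburger
  then have "v (Suc (Suc t)) = v (Suc t) + 2 *\<^sub>R S (v (Suc t)) - S (v t)" for t
    unfolding diff_eq_eq by (simp only: add.commute add_diff_eq)
  then have "v \<longlonglongrightarrow> 0"
    using skew_recurrence_tendsto_zero[OF S skew inj bound _ small, of v] \<open>0 < \<gamma>\<close> \<open>0 < \<eta>\<close>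
    by (meson mult_nonneg_nonneg less_imp_le)
  moreover have "P \<noteq> 0"
    using assms(3) by auto
  ultimately have "w \<longlonglongrightarrow> 0"
    unfolding v_def by (rule tendsto_zero_shift_poly[OF _ assms(4), rotated])
  then have "x \<longlonglongrightarrow> 0" "y \<longlonglongrightarrow> 0"
    by (auto dest: tendsto_fst tendsto_snd simp: w_def[abs_def])
  then show ?thesis
    by (intro conjI allI nash_equilibrium_bilinear_game_iff[OF assms(1)])
qed

end
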